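(* Suppose $0\le\alpha<1$ and $\mu$ is a probability measure concentrated on a subset $A$ of $\mathbb{R}^m$ with $\dim_{box}(A)<\frac{1}{1-\alpha}$. Then $\mu\in\mathcal{P}_\alpha(\mathbb{R}^m)$.
   Context: **Atomic measures.** A (finite) atomic measure on $\mathbb{R}^m$ is $\mathbf{a}=\sum_{i=1}^k m_i\delta_{x_i}$ with distinct $x_i\in\mathbb{R}^m$ and $m_i>0$; its mass is $\sum_i m_i$. $\mathcal{A}(\mathbb{R}^m)$ is the set of atomic probability measures. **Transport paths (for $0\le\alpha\le1$).** For atomic measures $\mathbf{a}=\sum_{i=1}^k m_i\delta_{x_i}$, $\mathbf{b}=\sum_{j=1}^\ell n_j\delta_{y_j}$ of equal mass, a transport path from $\mathbf{a}$ to $\mathbf{b}$ is a finite weighted directed graph $G$ with vertex set $V(G)\subset\mathbb{R}^m$ containing all $x_i,y_j$, directed edge set $E(G)$ (straight segments) and weights $w:E(G)\to(0,\infty)$ such that at each vertex $v$ $$\sum_{e^-=v}w(e)=\sum_{e^+=v}w(e)+(m_i\text{ if }v=x_i)+(-n_j\text{ if }v=y_j),$$ where $e^-,e^+$ are the start and end points of $e$ (both extra terms occur if $v=x_i=y_j$). $Path(\mathbf{a},\mathbf{b})$ is the set of these, $\mathbf{M}_\alpha(G)=\sum_{e\in E(G)}w(e)^\alpha\,\mathrm{length}(e)$ and $d_\alpha(\mathbf{a},\mathbf{b})=\inf\{\mathbf{M}_\alpha(G):G\in Path(\mathbf{a},\mathbf{b})\}$, a metric on $\mathcal{A}(\mathbb{R}^m)$.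 **$\mathcal{P}_\alpha$.** $\mathcal{P}_\alpha(\mathbb{R}^m)$ is the metric completion of $(\mathcal{A}(\mathbb{R}^m),d_\alpha)$. Its elements are viewed as probability measures: a probability measure $\mu$ belongs to $\mathcal{P}_\alpha(\mathbb{R}^m)$ if it is represented by a $d_\alpha$-Cauchy sequence in $\mathcal{A}(\mathbb{R}^m)$, i.e. one that converges weakly to $\mu$. **Other notions.** $\dim_{box}(A)$ is the infimum of the $\beta>0$ for which there is a constant $C_\beta$ such that for all $\delta<1$ the set $A$ can be covered by $C_\beta\delta^{-\beta}$ balls of radius $\delta$. A positive Borel measure $\mu$ is concentrated on a Borel set $A$ if $\mu(\mathbb{R}^m\setminus A)=0$. *)

theory Defs
  imports "HOL-Probability.Probability" "Graph_Theory.Pair_Digraph"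
begin

definition finite_atomic_measure :: "'a::euclidean_space measure \<Rightarrow> bool" where
  "finite_atomic_measure a \<longleftrightarrow>
     sets a = sets borel \<and>
     (\<exists>X m. finite X \<and> (\<forall>x\<in>X. 0 < m x) \<and>
        (\<forall>B\<in>sets borel. emeasure a B = (\<Sum>x\<in>X. ennreal (m x) * emeasure (return borel x) B)))"

definition atomic_prob_measures :: "'a::euclidean_space measure set" where
  "atomic_prob_measures = {a. finite_atomic_measure a \<and> prob_space a}"

text \<open>
  A weighted directed graph is a pair \<open>(G, w)\<close>; an edge is the pair (start point, end point).
  The mass \<open>m\<^sub>i\<close> that an atomic measure \<open>a\<close> carries at \<open>v = x\<^sub>i\<close> is \<open>measure a {v}\<close>,
  which is 0 if \<open>v\<close> is none of the \<open>x\<^sub>i\<close>.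
\<close>

definition transport_paths ::
  "'a::euclidean_space measure \<Rightarrow> 'a measure \<Rightarrow> ('a pair_pre_digraph \<times> ('a \<times> 'a \<Rightarrow> real)) set" where
  "transport_paths a b = {(G, w).
     finite_atomic_measure a \<and> finite_atomic_measure b \<and> emeasure a UNIV = emeasure b UNIV \<and>
     pair_fin_digraph G \<and>
     {x. 0 < measure a {x}} \<union> {y. 0 < measure b {y}} \<subseteq> pverts G \<and>
     (\<forall>e\<in>parcs G. 0 < w e) \<and>
     (\<forall>v\<in>pverts G.
        (\<Sum>e\<in>out_arcs (with_proj G) v. w e) =
        (\<Sum>e\<in>in_arcs (with_proj G) v. w e) + measure a {v} - measure b {v})}"

definition M_cost ::
  "real \<Rightarrow> 'a::euclidean_space pair_pre_digraph \<times> ('a \<times> 'a \<Rightarrow> real) \<Rightarrow> real" where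
  "M_cost \<alpha> = (\<lambda>(G, w). \<Sum>e\<in>parcs G. w e powr \<alpha> * dist (fst e) (snd e))"

definition d_transport :: "real \<Rightarrow> 'a::euclidean_space measure \<Rightarrow> 'a measure \<Rightarrow> real" where
  "d_transport \<alpha> a b = (INF P \<in> transport_paths a b. M_cost \<alpha> P)"

definition converges_weakly ::
  "(nat \<Rightarrow> 'a::euclidean_space measure) \<Rightarrow> 'a measure \<Rightarrow> bool" where
  "converges_weakly a \<mu> \<longleftrightarrow>
     (\<forall>f :: 'a \<Rightarrow> real. continuous_on UNIV f \<longrightarrow> bounded (range f) \<longrightarrow>
        (\<lambda>n. \<integral>x. f x \<partial>(a n)) \<longlonglongrightarrow> (\<integral>x. f x \<partial>\<mu>))"

text \<open>
  The completion of the atomic probability measures with respect to \<open>d_transport \<alpha>\<close>, an element of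
  the completion being identified with the weak limit of the Cauchy sequences that represent it.
  The Cauchy condition is \<open>Metric_space.MCauchy\<close> written out, as that constant presupposes a proof
  that \<open>d_transport \<alpha>\<close> is a metric.
\<close>

definition P_transport :: "real \<Rightarrow> 'a::euclidean_space measure set" where
  "P_transport \<alpha> = {\<mu>. prob_space \<mu> \<and> sets \<mu> = sets borel \<and>
     (\<exists>a. range a \<subseteq> atomic_prob_measures \<and>
        (\<forall>\<epsilon>>0. \<exists>N. \<forall>i j. N \<le> i \<longrightarrow> N \<le> j \<longrightarrow> d_transport \<alpha> (a i) (a j) < \<epsilon>) \<and>
        converges_weakly a \<mu>)}"

text \<open>
  Extended real valued, so that the dimension is \<open>\<infinity>\<close> when no exponent is admissible.
\<close>

definition box_dim :: "'a::euclidean_space set \<Rightarrow> ereal" where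
  "box_dim A = (INF \<beta> \<in> {\<beta>. 0 < \<beta> \<and>
     (\<exists>C. \<forall>\<delta>. 0 < \<delta> \<longrightarrow> \<delta> < 1 \<longrightarrow>
        (\<exists>F. finite F \<and> real (card F) \<le> C * \<delta> powr (- \<beta>) \<and> A \<subseteq> (\<Union>x\<in>F. ball x \<delta>)))}. ereal \<beta>)"

definition concentrated_on :: "'a::euclidean_space measure \<Rightarrow> 'a set \<Rightarrow> bool" where
  "concentrated_on \<mu> A \<longleftrightarrow> sets \<mu> = sets borel \<and> A \<in> sets borel \<and> emeasure \<mu> (UNIV - A) = 0"

end

(* Partition space into dyadic cubes of side 2^-(n+1) and let a_n place the mass of each cube at its
   corner. Moving a_{n+1} to a_n uses at most one edge per cube of generation n+1 that meets A; there
   are O(2^(n beta)) of these for some beta < 1/(1 - alpha). Their masses add up to at most 1, so by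
   concavity of t^alpha the cost of this step is O(2^(n beta (1 - alpha)) 2^-n), which is summable. *)
theory Submission
  imports Defs
begin

section \<open>Two inequalities for sums of \<alpha>-th powers\<close>

text \<open>Relative to the total \<open>s\<close>, each share \<open>x i / s\<close> lies in
  [0, 1], where t is at most its \<alpha>-th power; the shares sum to 1. This pays for merging the
  masses that use the same edge in different steps.\<close>

lemma powr_sum_subadditive:
  fixes x :: "'i \<Rightarrow> real"
  assumes "finite I" "\<And>i. i \<in> I \<Longrightarrow> 0 \<le> x i" "0 \<le> \<alpha>" "\<alpha> \<le> 1"
  shows "(\<Sum>i\<in>I. x i) powr \<alpha> \<le> (\<Sum>i\<in>I. x i powr \<alpha>)"
proof (cases "(\<Sum>i\<in>I. x i) = 0")
  case True
  then show ?thesis by (simp add: sum_nonneg)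
next
  case False
  define s where "s = (\<Sum>i\<in>I. x i)"
  have s: "0 < s" using False assms(2) sum_nonneg[of I x] by (simp add: s_def)
  have "s powr \<alpha> = (\<Sum>i\<in>I. s powr \<alpha> * (x i / s))"
    using s by (simp add: sum_distrib_left[symmetric] sum_divide_distrib[symmetric] s_def[symmetric])
  also have "\<dots> \<le> (\<Sum>i\<in>I. x i powr \<alpha>)"
  proof (rule sum_mono)
    fix i assume i: "i \<in> I"
    have "x i \<le> s" unfolding s_def by (rule member_le_sum) (use i assms in auto)
    moreover have "0 \<le> x i" using i assms by auto
    ultimately have "x i / s \<le> (x i / s) powr \<alpha>"
      using powr_mono'[of \<alpha> 1 "x i / s"] s assms by simp
    then have "s powr \<alpha> * (x i / s) \<le> s powr \<alpha> * (x i / s) powr \<alpha>"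
      by (intro mult_left_mono) auto
    also have "\<dots> = x i powr \<alpha>" using s by (simp add: powr_mult[symmetric])
    finally show "s powr \<alpha> * (x i / s) \<le> x i powr \<alpha>" .
  qed
  finally show ?thesis by (simp add: s_def)
qed

text \<open>Concavity makes equal masses \<open>1 / n\<close> the worst case, and n of these give n
  times the \<alpha>-th power of \<open>1 / n\<close>. This turns a count of edges into a bound on
  cost.\<close>

lemma sum_powr_le_card_powr:
  fixes x :: "'i \<Rightarrow> real"
  assumes "finite I" "\<And>i. i \<in> I \<Longrightarrow> 0 \<le> x i" "(\<Sum>i\<in>I. x i) \<le> 1" "0 \<le> \<alpha>" "\<alpha> \<le> 1"
  shows "(\<Sum>i\<in>I. x i powr \<alpha>) \<le> real (card I) powr (1 - \<alpha>)"
proof (cases "I = {}")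
  case False
  define n where "n = real (card I)"
  have n: "0 < n" using False assms(1) by (simp add: n_def card_gt_0_iff)
  \<comment> \<open>The right-hand side is the tangent line to the \<alpha>-th power at
    \<open>1 / n\<close>; it comes from the weighted AM-GM inequality for \<open>n * x i\<close> and
    1. That inequality wants positive numbers, so \<open>x i = 0\<close> is split off.\<close>
  have *: "x i powr \<alpha> \<le> n powr (- \<alpha>) * (\<alpha> * (n * x i) + (1 - \<alpha>))" if i: "i \<in> I" for i
  proof (cases "x i = 0")
    case True
    then show ?thesis using assms by simp
  next
    case False
    then have "0 < x i" using assms(2)[OF i] by simp
    then have "(n * x i) powr \<alpha> * 1 powr (1 - \<alpha>) \<le> \<alpha> * (n * x i) + (1 - \<alpha>) * 1"
      using n assms by (intro Youngs_inequality_0) auto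
    then have "n powr (- \<alpha>) * ((n * x i) powr \<alpha>) \<le> n powr (- \<alpha>) * (\<alpha> * (n * x i) + (1 - \<alpha>))"
      by (intro mult_left_mono) auto
    moreover have "n powr (- \<alpha>) * ((n * x i) powr \<alpha>) = x i powr \<alpha>"
      using n by (simp add: powr_mult powr_minus field_simps)
    ultimately show ?thesis by simp
  qed
  have "(\<Sum>i\<in>I. x i powr \<alpha>) \<le> (\<Sum>i\<in>I. n powr (- \<alpha>) * (\<alpha> * (n * x i) + (1 - \<alpha>)))"
    by (rule sum_mono) (rule *)
  also have "\<dots> = n powr (- \<alpha>) * (\<alpha> * n * (\<Sum>i\<in>I. x i) + n * (1 - \<alpha>))"
    by (simp add: sum_distrib_left[symmetric] sum.distrib n_def mult.assoc)
  also have "\<dots> \<le> n powr (- \<alpha>) * (\<alpha> * n * 1 + n * (1 - \<alpha>))"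
    using assms n by (intro mult_left_mono add_right_mono) auto
  also have "\<dots> = n powr (- \<alpha>) * n powr 1"
    using n by (simp add: field_simps)
  also have "\<dots> = n powr (1 - \<alpha>)"
    unfolding powr_add[symmetric] by simp
  finally show ?thesis by (simp add: n_def)
qed simp

section \<open>Laws of simple functions as atomic measures\<close>

context prob_space
begin

text \<open>The fibres of \<open>g\<close> partition \<open>B\<close>. Since \<open>V\<close> may
  exceed the range of \<open>g\<close> (the extra fibres are empty), one vertex set can later serve
  all maps of a chain.\<close>

lemma sum_prob_fibres:
  assumes g: "simple_function M g" and V: "finite V" "g ` space M \<subseteq> V" and B: "B \<in> sets M"
  shows "(\<Sum>v\<in>V. prob {x \<in> B. g x = v}) = prob B"
proof -
  have m: "{x \<in> B. g x = v} \<in> sets M" for v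
  proof -
    have "{x \<in> B. g x = v} = B \<inter> (g -` {v} \<inter> space M)" using sets.sets_into_space[OF B] by auto
    then show ?thesis using B simple_functionD(2)[OF g] by simp
  qed
  have "B = (\<Union>v\<in>V. {x \<in> B. g x = v})" using V sets.sets_into_space[OF B] by auto
  then have "prob B = prob (\<Union>v\<in>V. {x \<in> B. g x = v})" by simp
  also have "\<dots> = (\<Sum>v\<in>V. prob {x \<in> B. g x = v})"
    by (rule finite_measure_finite_Union) (use V m in \<open>auto simp: disjoint_family_on_def\<close>)
  finally show ?thesis by simp
qed

lemma measure_distr_singleton:
  fixes f :: "'a \<Rightarrow> 'b::euclidean_space"
  assumes "simple_function M f"
  shows "measure (distr M borel f) {v} = prob {x \<in> space M. f x = v}"
proof -
  have "measure (distr M borel f) {v} = prob (f -` {v} \<inter> space M)"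
    by (rule measure_distr) (use borel_measurable_simple_function[OF assms] in auto)
  also have "f -` {v} \<inter> space M = {x \<in> space M. f x = v}" by auto
  finally show ?thesis .
qed

lemma finite_atomic_measure_distr:
  fixes f :: "'a \<Rightarrow> 'b::euclidean_space"
  assumes f: "simple_function M f"
  shows "finite_atomic_measure (distr M borel f)"
  unfolding finite_atomic_measure_def
proof (intro conjI exI ballI)
  let ?m = "\<lambda>u. prob {x \<in> space M. f x = u}"
  \<comment> \<open>Values taken with probability 0 are discarded because the weights of an atomic
    measure must be positive.\<close>
  let ?X = "{u \<in> f ` space M. 0 < ?m u}"
  have fin: "finite (f ` space M)" using f by (rule simple_functionD)
  show "sets (distr M borel f) = sets borel" by simp
  show "finite ?X" using fin by simp
  show "0 < ?m u" if "u \<in> ?X" for u using that by simp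
  fix B :: "'b set" assume B: "B \<in> sets borel"
  have fm: "f \<in> borel_measurable M" using f by (rule borel_measurable_simple_function)
  have fB: "f -` B \<inter> space M \<in> sets M" using fm B by (rule measurable_sets)
  have "measure M (f -` B \<inter> space M) = (\<Sum>u\<in>f ` space M. prob {x \<in> f -` B \<inter> space M. f x = u})"
    by (rule sum_prob_fibres[symmetric]) (use f fin fB in auto)
  also have "\<dots> = (\<Sum>u\<in>f ` space M. ?m u * indicator B u)"
  proof (rule sum.cong)
    fix u
    have "{x \<in> f -` B \<inter> space M. f x = u} = (if u \<in> B then {x \<in> space M. f x = u} else {})" by auto
    then show "prob {x \<in> f -` B \<inter> space M. f x = u} = ?m u * indicator B u" by simp
  qed simp
  also have "\<dots> = (\<Sum>u\<in>?X. ?m u * indicator B u)"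
    by (rule sum.mono_neutral_right) (use fin in \<open>auto simp: zero_less_measure_iff\<close>)
  finally have *: "measure M (f -` B \<inter> space M) = (\<Sum>u\<in>?X. ?m u * indicator B u)" .
  have "emeasure (distr M borel f) B = emeasure M (f -` B \<inter> space M)"
    by (rule emeasure_distr[OF fm B])
  also have "\<dots> = ennreal (\<Sum>u\<in>?X. ?m u * indicator B u)"
    by (simp add: emeasure_eq_measure *)
  also have "\<dots> = (\<Sum>u\<in>?X. ennreal (?m u) * emeasure (return borel u) B)"
    using B by (subst sum_ennreal[symmetric])
      (auto intro!: sum.cong simp: ennreal_mult ennreal_indicator split: split_indicator)
  finally show "emeasure (distr M borel f) B = (\<Sum>u\<in>?X. ennreal (?m u) * emeasure (return borel u) B)" .
qed

end


section \<open>Transport along a chain of simple functions\<close>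

lemma M_cost_nonneg: "0 \<le> M_cost \<alpha> P"
  by (cases P) (auto simp: M_cost_def intro!: sum_nonneg)

lemma d_transport_le:
  assumes "P \<in> transport_paths a b"
  shows "d_transport \<alpha> a b \<le> M_cost \<alpha> P"
  unfolding d_transport_def
  by (rule cINF_lower[OF _ assms]) (auto intro!: bdd_belowI[of _ 0] M_cost_nonneg)

text \<open>The mass at \<open>x\<close> travels along \<open>f 0 x\<close>, \<open>f 1 x\<close>,
  ..., \<open>f k x\<close>, and superposing these routes gives one transport path that carries all
  \<open>k\<close> steps. Step \<open>l\<close> uses at most \<open>N l\<close> edges, each no
  longer than \<open>D l\<close>, with masses of total at most 1.\<close>

lemma (in prob_space) d_transport_distr_chain:
  fixes f :: "nat \<Rightarrow> 'a \<Rightarrow> 'b::euclidean_space"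
  assumes \<alpha>: "0 \<le> \<alpha>" "\<alpha> \<le> 1"
    and f: "\<And>l. l \<le> k \<Longrightarrow> simple_function M (f l)"
    and D: "\<And>l x. l < k \<Longrightarrow> x \<in> space M \<Longrightarrow> dist (f l x) (f (Suc l) x) \<le> D l"
    and N: "\<And>l. l < k \<Longrightarrow> real (card ((\<lambda>x. (f l x, f (Suc l) x)) ` space M)) \<le> N l"
  shows "d_transport \<alpha> (distr M borel (f 0)) (distr M borel (f k))
    \<le> (\<Sum>l<k. N l powr (1 - \<alpha>) * D l)"
proof -
  \<comment> \<open>\<open>p l\<close> is the joint law of \<open>f l\<close> and
    \<open>f (Suc l)\<close>, that is, a transport plan between their laws. Its two marginals are
    computed in \<open>out\<close> and \<open>inn\<close>.\<close>
  define p where "p l e = prob {x \<in> space M. (f l x, f (Suc l) x) = e}" for l e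
  \<comment> \<open>An edge that recurs in several steps carries the total of its masses, as there are no parallel edges;
    by subadditivity this only lowers the cost.\<close>
  define w where "w e = (\<Sum>l<k. p l e)" for e
  define V where "V = (\<Union>l\<le>k. f l ` space M)"
  \<comment> \<open>Edge weights have to be positive, hence the restriction. Loops may occur, where
    a step leaves a point fixed; they have length 0 and enter both sides of the balance
    equally.\<close>
  define E where "E = {e \<in> V \<times> V. 0 < w e}"
  define G where "G = \<lparr>pverts = V, parcs = E\<rparr>"
  let ?q = "\<lambda>l v. prob {x \<in> space M. f l x = v}"
  have p0: "0 \<le> p l e" for l e by (simp add: p_def)
  have w0: "0 \<le> w e" for e by (simp add: w_def sum_nonneg p0)
  have finV: "finite V" using simple_functionD(1)[OF f] by (auto simp: V_def)
  have finE: "finite E" using finV by (simp add: E_def)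
  have fV: "f l ` space M \<subseteq> V" if "l \<le> k" for l using that by (auto simp: V_def)
  have fibre: "{x \<in> space M. f l x = v} \<in> sets M" if "l \<le> k" for l v
    using simple_functionD(2)[OF f[OF that], of "{v}"]
    by (simp add: vimage_def Int_def conj_commute)
  have out: "(\<Sum>u\<in>V. p l (v, u)) = ?q l v" if "l < k" for l v
    using sum_prob_fibres[OF f finV fV fibre, of "Suc l" l v] that by (simp add: p_def)
  have inn: "(\<Sum>u\<in>V. p l (u, v)) = ?q (Suc l) v" if "l < k" for l v
    using sum_prob_fibres[OF f finV fV fibre, of l "Suc l" v] that
    by (simp add: p_def conj_ac)
  \<comment> \<open>Mass balance: the outflow at \<open>v\<close> adds the masses at times 0 to k-1,
    the inflow those at times 1 to k, so the difference telescopes. Pairs left out of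
    \<open>E\<close> have weight 0, so both sums may run over all of \<open>V\<close>.\<close>
  have "(\<Sum>e\<in>out_arcs (with_proj G) v. w e) =
      (\<Sum>e\<in>in_arcs (with_proj G) v. w e) + ?q 0 v - ?q k v" if v: "v \<in> V" for v
  proof -
    have "(\<Sum>e\<in>out_arcs (with_proj G) v. w e) = (\<Sum>e\<in>(\<lambda>u. (v, u)) ` V. w e)"
      by (rule sum.mono_neutral_left)
        (use finV v w0 in \<open>auto simp: out_arcs_def G_def E_def less_le\<close>)
    also have "\<dots> = (\<Sum>u\<in>V. w (v, u))" by (subst sum.reindex) (auto simp: inj_on_def)
    also have "\<dots> = (\<Sum>l<k. ?q l v)"
      unfolding w_def by (subst sum.swap) (simp add: out)
    finally have o: "(\<Sum>e\<in>out_arcs (with_proj G) v. w e) = (\<Sum>l<k. ?q l v)" .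
    have "(\<Sum>e\<in>in_arcs (with_proj G) v. w e) = (\<Sum>e\<in>(\<lambda>u. (u, v)) ` V. w e)"
      by (rule sum.mono_neutral_left)
        (use finV v w0 in \<open>auto simp: in_arcs_def G_def E_def less_le\<close>)
    also have "\<dots> = (\<Sum>u\<in>V. w (u, v))" by (subst sum.reindex) (auto simp: inj_on_def)
    also have "\<dots> = (\<Sum>l<k. ?q (Suc l) v)"
      unfolding w_def by (subst sum.swap) (simp add: inn)
    finally have "(\<Sum>e\<in>in_arcs (with_proj G) v. w e) = (\<Sum>l<k. ?q (Suc l) v)" .
    then show ?thesis
      using o sum_lessThan_telescope[of "\<lambda>l. ?q l v" k] by (simp add: sum_subtractf)
  qed
  moreover have "v \<in> V" if "0 < ?q l v" "l \<le> k" for l v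
  proof (rule ccontr)
    assume "v \<notin> V"
    then have "{x \<in> space M. f l x = v} = {}" using fV[OF that(2)] by auto
    then show False using that(1) by (metis less_irrefl measure_empty)
  qed
  moreover have "emeasure (distr M borel (f l)) UNIV = 1" if "l \<le> k" for l
    using prob_space.emeasure_space_1[OF prob_space_distr[OF borel_measurable_simple_function[OF f[OF that]]]]
    by simp
  ultimately have path: "(G, w) \<in> transport_paths (distr M borel (f 0)) (distr M borel (f k))"
    using finV finE unfolding transport_paths_def
    by (auto simp: finite_atomic_measure_distr f measure_distr_singleton pair_fin_digraph_def
      pair_wf_digraph_def pair_fin_digraph_axioms_def G_def E_def)
  \<comment> \<open>The cost of step \<open>l\<close> alone. \<open>E\<close> may contain edges of
    other steps, and the range of \<open>g\<close> may contain pairs of mass 0 that are not in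
    \<open>E\<close>; the union of the two sets mediates.\<close>
  have level: "(\<Sum>e\<in>E. p l e powr \<alpha> * dist (fst e) (snd e)) \<le> N l powr (1 - \<alpha>) * D l"
    if l: "l < k" for l
  proof -
    define g where "g x = (f l x, f (Suc l) x)" for x
    have g: "simple_function M g" unfolding g_def
      using l by (intro simple_function_Pair f) auto
    have fing: "finite (g ` space M)" using g by (rule simple_functionD)
    \<comment> \<open>A probability space has a point, and at that point \<open>D l\<close> bounds a
      distance.\<close>
    have D0: "0 \<le> D l"
      using D[OF l] not_empty order_trans[OF zero_le_dist] by blast
    have pz: "p l e = 0" if "e \<notin> g ` space M" for e
    proof -
      have "{x \<in> space M. g x = e} = {}" using that by auto
      then show ?thesis unfolding p_def g_def by (metis measure_empty)
    qed
    have "(\<Sum>e\<in>E. p l e powr \<alpha> * dist (fst e) (snd e))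
        \<le> (\<Sum>e\<in>E \<union> g ` space M. p l e powr \<alpha> * dist (fst e) (snd e))"
      by (rule sum_mono2) (use finE fing in auto)
    also have "\<dots> = (\<Sum>e\<in>g ` space M. p l e powr \<alpha> * dist (fst e) (snd e))"
      by (rule sum.mono_neutral_right) (use finE fing pz in auto)
    also have "\<dots> \<le> (\<Sum>e\<in>g ` space M. p l e powr \<alpha> * D l)"
      by (rule sum_mono) (auto intro!: mult_left_mono D l simp: g_def)
    also have "\<dots> = (\<Sum>e\<in>g ` space M. p l e powr \<alpha>) * D l" by (simp add: sum_distrib_right)
    also have "\<dots> \<le> real (card (g ` space M)) powr (1 - \<alpha>) * D l"
    proof (intro mult_right_mono sum_powr_le_card_powr fing p0 \<alpha> D0)
      show "(\<Sum>e\<in>g ` space M. p l e) \<le> 1"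
        using sum_prob_fibres[OF g fing order_refl sets.top] by (simp add: p_def g_def)
    qed
    also have "\<dots> \<le> N l powr (1 - \<alpha>) * D l"
      using N[OF l] \<alpha> D0 by (intro mult_right_mono powr_mono2) (auto simp: g_def)
    finally show ?thesis .
  qed
  have "d_transport \<alpha> (distr M borel (f 0)) (distr M borel (f k)) \<le> M_cost \<alpha> (G, w)"
    using path by (rule d_transport_le)
  also have "\<dots> = (\<Sum>e\<in>E. (\<Sum>l<k. p l e) powr \<alpha> * dist (fst e) (snd e))"
    by (simp add: M_cost_def G_def w_def)
  also have "\<dots> \<le> (\<Sum>e\<in>E. (\<Sum>l<k. p l e powr \<alpha>) * dist (fst e) (snd e))"
    by (intro sum_mono mult_right_mono powr_sum_subadditive) (auto simp: p0 \<alpha>)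
  also have "\<dots> = (\<Sum>l<k. \<Sum>e\<in>E. p l e powr \<alpha> * dist (fst e) (snd e))"
    by (subst sum.swap) (simp add: sum_distrib_right)
  also have "\<dots> \<le> (\<Sum>l<k. N l powr (1 - \<alpha>) * D l)"
    by (rule sum_mono) (simp add: level)
  finally show ?thesis .
qed


section \<open>Cubical grids and box dimension\<close>

text \<open>For positive \<delta> this is the lowest corner of the half-open cube of side \<delta>
  containing \<open>x\<close>. All grids are anchored at the origin, so halving \<delta> refines the
  partition.\<close>

definition grid_point :: "real \<Rightarrow> 'a::euclidean_space \<Rightarrow> 'a" where
  "grid_point \<delta> x = (\<Sum>b\<in>Basis. (\<delta> * of_int \<lfloor>x \<bullet> b / \<delta>\<rfloor>) *\<^sub>R b)"

lemma grid_point_inner: "b \<in> Basis \<Longrightarrow> grid_point \<delta> x \<bullet> b = \<delta> * of_int \<lfloor>x \<bullet> b / \<delta>\<rfloor>"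
  by (simp add: grid_point_def)

lemma borel_measurable_grid_point [measurable]: "grid_point \<delta> \<in> borel_measurable borel"
  unfolding grid_point_def by measurable

text \<open>Rounding down moves each coordinate by at most \<delta>; passing through the l1 norm
  gives the dimension as factor.\<close>

lemma dist_grid_point_le:
  fixes x :: "'a::euclidean_space"
  assumes "0 < \<delta>"
  shows "dist (grid_point \<delta> x) x \<le> real DIM('a) * \<delta>"
proof -
  have "dist (grid_point \<delta> x) x \<le> (\<Sum>b\<in>Basis. \<bar>(grid_point \<delta> x - x) \<bullet> b\<bar>)"
    unfolding dist_norm by (rule norm_le_l1)
  also have "\<dots> \<le> (\<Sum>b\<in>(Basis::'a set). \<delta>)"
  proof (rule sum_mono)
    fix b :: 'a assume b: "b \<in> Basis"
    define y where "y = x \<bullet> b / \<delta>"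
    have xy: "x \<bullet> b = \<delta> * y" using assms by (simp add: y_def)
    have "\<bar>(grid_point \<delta> x - x) \<bullet> b\<bar> = \<delta> * \<bar>of_int \<lfloor>y\<rfloor> - y\<bar>"
      using assms unfolding inner_diff_left grid_point_inner[OF b] y_def[symmetric] xy
      by (simp add: right_diff_distrib[symmetric] abs_mult)
    also have "\<dots> \<le> \<delta> * 1" using assms by (intro mult_left_mono) linarith+
    finally show "\<bar>(grid_point \<delta> x - x) \<bullet> b\<bar> \<le> \<delta>" by simp
  qed
  finally show ?thesis by simp
qed

text \<open>Nesting of dyadic intervals in one dimension: the floor of \<open>2 * y\<close> is twice
  the floor of \<open>y\<close>, or one more.\<close>

lemma floor_half_floor_double: "\<lfloor>(of_int \<lfloor>2 * y\<rfloor> :: real) / 2\<rfloor> = \<lfloor>y\<rfloor>" for y :: real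
proof (rule floor_unique)
  have "2 * \<lfloor>y\<rfloor> \<le> \<lfloor>2 * y\<rfloor>" unfolding le_floor_iff by simp
  then have "real_of_int (2 * \<lfloor>y\<rfloor>) \<le> real_of_int \<lfloor>2 * y\<rfloor>" by (simp only: of_int_le_iff)
  then show "of_int \<lfloor>y\<rfloor> \<le> (of_int \<lfloor>2 * y\<rfloor> :: real) / 2" by simp
  show "(of_int \<lfloor>2 * y\<rfloor> :: real) / 2 < of_int \<lfloor>y\<rfloor> + 1" by linarith
qed

text \<open>Each fine cube lies in one coarse cube, so its corner determines the coarse corner. For
  this reason an edge between consecutive generations is determined by its fine end.\<close>

lemma grid_point_half:
  assumes "0 < \<delta>"
  shows "grid_point \<delta> (grid_point (\<delta> / 2) x) = grid_point \<delta> x"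
proof (rule euclidean_eqI)
  fix b :: 'a assume b: "b \<in> Basis"
  have "\<lfloor>(\<delta> / 2 * of_int \<lfloor>x \<bullet> b / (\<delta> / 2)\<rfloor>) / \<delta>\<rfloor> = \<lfloor>(of_int \<lfloor>2 * (x \<bullet> b / \<delta>)\<rfloor> :: real) / 2\<rfloor>"
    using assms by (simp add: mult_ac)
  then show "grid_point \<delta> (grid_point (\<delta> / 2) x) \<bullet> b = grid_point \<delta> x \<bullet> b"
    using assms b unfolding floor_half_floor_double by (simp only: grid_point_inner[OF b])
qed

text \<open>Within the ball each scaled coordinate differs from that of the centre by less than 1,
  so its floor differs by at most 1: three choices per coordinate.\<close>

lemma grid_point_image_ball:
  fixes x :: "'a::euclidean_space"
  assumes "0 < \<delta>"
  shows "finite (grid_point \<delta> ` ball x \<delta>)" "card (grid_point \<delta> ` ball x \<delta>) \<le> 3 ^ DIM('a)"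
proof -
  define T where "T b = {\<lfloor>x \<bullet> b / \<delta>\<rfloor> - 1 .. \<lfloor>x \<bullet> b / \<delta>\<rfloor> + 1}" for b
  define c :: "('a \<Rightarrow> int) \<Rightarrow> 'a" where "c k = (\<Sum>b\<in>Basis. (\<delta> * of_int (k b)) *\<^sub>R b)" for k
  have sub: "grid_point \<delta> ` ball x \<delta> \<subseteq> c ` Pi\<^sub>E Basis T"
  proof
    fix z assume "z \<in> grid_point \<delta> ` ball x \<delta>"
    then obtain y where y: "dist x y < \<delta>" and z: "z = grid_point \<delta> y" by auto
    define k where "k = restrict (\<lambda>b. \<lfloor>y \<bullet> b / \<delta>\<rfloor>) Basis"
    have "z = c k" by (simp add: z c_def k_def grid_point_def)
    moreover have "k \<in> Pi\<^sub>E Basis T"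
    proof
      fix b :: 'a assume b: "b \<in> Basis"
      have "\<bar>(x - y) \<bullet> b\<bar> < \<delta>"
        using Basis_le_norm[OF b, of "x - y"] y by (simp add: dist_norm)
      then have "\<bar>x \<bullet> b / \<delta> - y \<bullet> b / \<delta>\<bar> < 1"
        using assms by (simp add: inner_diff_left diff_divide_distrib[symmetric])
      then show "k b \<in> T b" using b unfolding k_def T_def by simp linarith
    qed (simp add: k_def)
    ultimately show "z \<in> c ` Pi\<^sub>E Basis T" by blast
  qed
  have fin: "finite (Pi\<^sub>E Basis T)" by (rule finite_PiE) (auto simp: T_def)
  show "finite (grid_point \<delta> ` ball x \<delta>)" using sub fin by (rule finite_surj[rotated])
  have "card (grid_point \<delta> ` ball x \<delta>) \<le> card (Pi\<^sub>E Basis T)"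
    using sub fin by (rule surj_card_le[rotated])
  also have "\<dots> = 3 ^ DIM('a)" by (simp add: card_PiE T_def)
  finally show "card (grid_point \<delta> ` ball x \<delta>) \<le> 3 ^ DIM('a)" .
qed

lemma grid_point_image_cover:
  fixes A :: "'a::euclidean_space set"
  assumes "0 < \<delta>" "finite F" "A \<subseteq> (\<Union>x\<in>F. ball x \<delta>)"
  shows "finite (grid_point \<delta> ` A)" "card (grid_point \<delta> ` A) \<le> card F * 3 ^ DIM('a)"
proof -
  have sub: "grid_point \<delta> ` A \<subseteq> (\<Union>x\<in>F. grid_point \<delta> ` ball x \<delta>)" using assms(3) by blast
  have fin: "finite (\<Union>x\<in>F. grid_point \<delta> ` ball x \<delta>)"
    using assms grid_point_image_ball(1) by blast
  show "finite (grid_point \<delta> ` A)" using sub fin by (rule finite_subset)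
  have "card (grid_point \<delta> ` A) \<le> card (\<Union>x\<in>F. grid_point \<delta> ` ball x \<delta>)"
    using fin sub by (rule card_mono)
  also have "\<dots> \<le> (\<Sum>x\<in>F. card (grid_point \<delta> ` ball x \<delta>))"
    using assms(2) by (rule card_UN_le)
  also have "\<dots> \<le> (\<Sum>x\<in>F. 3 ^ DIM('a))"
    by (rule sum_mono) (rule grid_point_image_ball(2)[OF assms(1)])
  finally show "card (grid_point \<delta> ` A) \<le> card F * 3 ^ DIM('a)" by simp
qed

text \<open>An infimum below \<open>d\<close> has an admissible exponent below \<open>d\<close>.
  Each covering ball meets at most \<open>3 ^ DIM('a)\<close> grid cubes, a factor absorbed into
  \<open>K\<close>, so counting cubes has the same exponent as counting balls.\<close>

lemma box_dim_less_grid_pointE: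
  fixes A :: "'a::euclidean_space set"
  assumes "box_dim A < ereal d"
  obtains \<beta> K where "\<beta> < d"
    "\<forall>\<delta>\<in>{0<..<1}. finite (grid_point \<delta> ` A) \<and> real (card (grid_point \<delta> ` A)) \<le> K * \<delta> powr (- \<beta>)"
proof -
  from assms obtain \<beta> C where \<beta>: "0 < \<beta>" "\<beta> < d"
    and C: "\<And>\<delta>. 0 < \<delta> \<Longrightarrow> \<delta> < 1 \<Longrightarrow>
      \<exists>F. finite F \<and> real (card F) \<le> C * \<delta> powr (- \<beta>) \<and> A \<subseteq> (\<Union>x\<in>F. ball x \<delta>)"
    unfolding box_dim_def INF_less_iff by auto
  define K where "K = C * 3 ^ DIM('a)"
  have "finite (grid_point \<delta> ` A) \<and> real (card (grid_point \<delta> ` A)) \<le> K * \<delta> powr (- \<beta>)"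
    if \<delta>: "0 < \<delta>" "\<delta> < 1" for \<delta>
  proof -
    from C[OF \<delta>] obtain F where F: "finite F" "real (card F) \<le> C * \<delta> powr (- \<beta>)"
      "A \<subseteq> (\<Union>x\<in>F. ball x \<delta>)" by blast
    have "real (card (grid_point \<delta> ` A)) \<le> real (card F) * 3 ^ DIM('a)"
      using of_nat_mono[OF grid_point_image_cover(2)[OF \<delta>(1) F(1,3)], where ?'a = real] by simp
    also have "\<dots> \<le> (C * \<delta> powr (- \<beta>)) * 3 ^ DIM('a)"
      using F(2) by (intro mult_right_mono) auto
    finally show ?thesis using grid_point_image_cover(1)[OF \<delta>(1) F(1,3)] by (simp add: K_def mult_ac)
  qed
  then show thesis using that[of \<beta> K] \<beta>(2) by simp
qed

section \<open>Dyadic approximation of the measure\<close>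

lemma P_transport_if_box_dim_less:
  fixes \<mu> :: "'a::euclidean_space measure"
  assumes \<alpha>: "0 \<le> \<alpha>" "\<alpha> < 1" and prob: "prob_space \<mu>" and A: "concentrated_on \<mu> A"
    and dim: "box_dim A < ereal (1 / (1 - \<alpha>))"
  shows "\<mu> \<in> P_transport \<alpha>"
proof -
  interpret prob_space \<mu> by (rule prob)
  have sets_\<mu>[measurable_cong, simp]: "sets \<mu> = sets borel"
    and A_borel[measurable]: "A \<in> sets borel" and null: "emeasure \<mu> (UNIV - A) = 0"
    using A by (auto simp: concentrated_on_def)
  have space_\<mu>[simp]: "space \<mu> = UNIV" using sets_eq_imp_space_eq[OF sets_\<mu>] by simp
  have "A \<noteq> {}" using null emeasure_space_1 by auto
  then obtain x0 where x0: "x0 \<in> A" by blast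
  have AE_A: "AE x in \<mu>. x \<in> A"
    by (rule AE_I[OF _ null]) auto

  \<comment> \<open>\<open>h\<close> is the identity \<open>\<mu>\<close>-almost everywhere; composing with it makes the grid maps simple functions.\<close>
  define h where "h x = (if x \<in> A then x else x0)" for x
  have h[measurable]: "h \<in> borel_measurable borel" unfolding h_def by measurable
  have hA: "h x \<in> A" for x using x0 by (simp add: h_def)

  obtain \<beta> K where \<beta>: "\<beta> < 1 / (1 - \<alpha>)"
    and K: "\<forall>\<delta>\<in>{0<..<1}. finite (grid_point \<delta> ` A) \<and> real (card (grid_point \<delta> ` A)) \<le> K * \<delta> powr (- \<beta>)"
    by (rule box_dim_less_grid_pointE[OF dim])
  have fin: "finite (grid_point \<delta> ` A)"
    and card: "real (card (grid_point \<delta> ` A)) \<le> K * \<delta> powr (- \<beta>)" if "0 < \<delta>" "\<delta> < 1" for \<delta>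
    using K that by simp_all
  \<comment> \<open>The exponent \<open>Suc n\<close> starts the scales at 1/2, since the count of
    cubes is available only for sides below 1.\<close>
  define \<delta> :: "nat \<Rightarrow> real" where "\<delta> n = (1 / 2) ^ Suc n" for n
  have \<delta>: "0 < \<delta> n" "\<delta> n < 1" for n by (auto simp: \<delta>_def power_less_one_iff simp del: power_Suc)
  have \<delta>_Suc: "\<delta> (Suc n) = \<delta> n / 2" for n by (simp add: \<delta>_def)
  define f where "f n x = grid_point (\<delta> n) (h x)" for n x
  have f_dist: "dist (f n x) (h x) \<le> real DIM('a) * \<delta> n" for n x
    unfolding f_def by (rule dist_grid_point_le) (rule \<delta>)
  have f_meas[measurable]: "f n \<in> borel_measurable borel" for n
    unfolding f_def by measurable
  have f_meas\<mu>: "f n \<in> borel_measurable \<mu>" for n by measurable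
  have f_range: "range (f n) \<subseteq> grid_point (\<delta> n) ` A" for n using hA by (auto simp: f_def)
  have f_simple: "simple_function \<mu> (f n)" for n
    using f_meas\<mu> finite_subset[OF f_range fin[OF \<delta>]]
    by (intro simple_function_borel_measurable) auto
  define a where "a n = distr \<mu> borel (f n)" for n

  \<comment> \<open>The cost bound between generations \<open>n\<close> and \<open>Suc n\<close>:
    edges are counted on the finer grid, lengths are measured by the coarser one.\<close>
  define c where "c n = (K * \<delta> (Suc n) powr (- \<beta>)) powr (1 - \<alpha>) * (2 * real DIM('a) * \<delta> n)" for n
  have step_dist: "dist (f n x) (f (Suc n) x) \<le> 2 * real DIM('a) * \<delta> n" for n x
  proof -
    have "dist (f n x) (f (Suc n) x) \<le> real DIM('a) * \<delta> n + real DIM('a) * \<delta> (Suc n)"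
      using dist_triangle2[of "f n x" "f (Suc n) x" "h x"] f_dist[of n x] f_dist[of "Suc n" x] by linarith
    also have "\<dots> \<le> real DIM('a) * \<delta> n + real DIM('a) * \<delta> n"
      using less_imp_le[OF \<delta>(1)[of n]] by (intro add_left_mono mult_left_mono) (auto simp: \<delta>_Suc)
    finally show ?thesis by (simp add: mult_ac)
  qed
  have coarsen: "grid_point (\<delta> n) (f (Suc n) x) = f n x" for n x
    using \<delta>(1)[of n] by (simp add: f_def \<delta>_Suc grid_point_half)
  \<comment> \<open>Here \<open>k\<close> rebuilds an edge from its fine end; it is applied below
    with the two ends in either order.\<close>
  have card_le: "real (card (range (\<lambda>x. k (f (Suc n) x)))) \<le> K * \<delta> (Suc n) powr (- \<beta>)"
    for n and k :: "'a \<Rightarrow> 'a \<times> 'a"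
  proof -
    have "range (\<lambda>x. k (f (Suc n) x)) \<subseteq> k ` (grid_point (\<delta> (Suc n)) ` A)"
      using f_range[of "Suc n"] by auto
    then have "card (range (\<lambda>x. k (f (Suc n) x))) \<le> card (grid_point (\<delta> (Suc n)) ` A)"
      by (rule surj_card_le[OF fin[OF \<delta>]])
    also have "real \<dots> \<le> K * \<delta> (Suc n) powr (- \<beta>)" by (rule card[OF \<delta>])
    finally show ?thesis by simp
  qed
  have card_up: "real (card (range (\<lambda>x. (f n x, f (Suc n) x)))) \<le> K * \<delta> (Suc n) powr (- \<beta>)"
    and card_down: "real (card (range (\<lambda>x. (f (Suc n) x, f n x)))) \<le> K * \<delta> (Suc n) powr (- \<beta>)" for n
    using card_le[of "\<lambda>y. (grid_point (\<delta> n) y, y)" n] card_le[of "\<lambda>y. (y, grid_point (\<delta> n) y)" n]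
    by (simp_all add: coarsen)

  have up: "d_transport \<alpha> (a i) (a (i + k)) \<le> (\<Sum>l<k. c (i + l))" for i k
    using d_transport_distr_chain[of \<alpha> k "\<lambda>l. f (i + l)"
        "\<lambda>l. 2 * real DIM('a) * \<delta> (i + l)" "\<lambda>l. K * \<delta> (Suc (i + l)) powr (- \<beta>)"]
      \<alpha> f_simple step_dist card_up
    by (simp add: a_def c_def)
  \<comment> \<open>The Cauchy condition takes the indices in both orders, so the chain is also run
    backwards, from fine to coarse. The terms \<open>k - 0\<close> and \<open>k - k\<close> are kept
    to match the chain whose map at position \<open>l\<close> is
    \<open>f (i + (k - l))\<close>.\<close>
  have down: "d_transport \<alpha> (a (i + k)) (a i) \<le> (\<Sum>l<k. c (i + l))" for i k
  proof -
    have "d_transport \<alpha> (distr \<mu> borel (f (i + (k - 0)))) (distr \<mu> borel (f (i + (k - k))))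
        \<le> (\<Sum>l<k. (K * \<delta> (Suc (i + (k - Suc l))) powr (- \<beta>)) powr (1 - \<alpha>)
            * (2 * real DIM('a) * \<delta> (i + (k - Suc l))))"
    proof (rule d_transport_distr_chain)
      fix l assume "l < k"
      then have l: "i + (k - l) = Suc (i + (k - Suc l))" by simp
      show "dist (f (i + (k - l)) x) (f (i + (k - Suc l)) x) \<le> 2 * real DIM('a) * \<delta> (i + (k - Suc l))" for x
        unfolding l using step_dist[of "i + (k - Suc l)" x] by (simp add: dist_commute)
      show "real (card ((\<lambda>x. (f (i + (k - l)) x, f (i + (k - Suc l)) x)) ` space \<mu>))
          \<le> K * \<delta> (Suc (i + (k - Suc l))) powr (- \<beta>)"
        unfolding l space_\<mu> by (rule card_down)
    qed (use \<alpha> f_simple in auto)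
    also have "\<dots> = (\<Sum>l<k. c (i + (k - Suc l)))" by (simp add: c_def)
    also have "\<dots> = (\<Sum>l<k. c (i + l))" by (rule sum.nat_diff_reindex)
    finally show ?thesis by (simp add: a_def)
  qed

  have "summable c"
  proof -
    \<comment> \<open>The dimension hypothesis enters as \<open>\<gamma> < 1\<close>. Per generation
      the edge factor grows by \<open>s\<close>, which is 2 to the power \<gamma>, while lengths
      halve, so the ratio \<open>r\<close> is below 1.\<close>
    define \<gamma> where "\<gamma> = \<beta> * (1 - \<alpha>)"
    have \<gamma>: "\<gamma> < 1" using \<beta> \<alpha> by (simp add: \<gamma>_def field_simps)
    define s :: real where "s = (1 / 2) powr (- \<gamma>)"
    define r where "r = s * (1 / 2)"
    have "r = (1 / 2) powr (- \<gamma>) * (1 / 2) powr 1" by (simp add: r_def s_def)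
    also have "\<dots> = (1 / 2) powr (1 - \<gamma>)" unfolding powr_add[symmetric] by simp
    also have "\<dots> < 1 powr (1 - \<gamma>)" using \<gamma> by (intro powr_less_mono2) auto
    finally have r: "0 \<le> r" "r < 1" by (simp_all add: r_def s_def)
    \<comment> \<open>\<open>\<delta> (Suc n)\<close> contributes \<open>s\<close> to the power n+2,
      but \<open>\<delta> n\<close> only 1/2 to the power n+1; the spare \<open>s\<close> goes into
      the constant.\<close>
    have "c = (\<lambda>n. (K powr (1 - \<alpha>) * s * 2 * real DIM('a)) * r ^ Suc n)"
    proof
      fix n
      have "(K * \<delta> (Suc n) powr (- \<beta>)) powr (1 - \<alpha>) = K powr (1 - \<alpha>) * \<delta> (Suc n) powr (- \<gamma>)"
        by (simp add: powr_mult powr_powr \<gamma>_def)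
      also have "\<delta> (Suc n) powr (- \<gamma>) = s ^ Suc (Suc n)"
        by (simp add: \<delta>_def s_def powr_realpow[symmetric] powr_powr powr_power mult.commute del: power_Suc)
      finally show "c n = (K powr (1 - \<alpha>) * s * 2 * real DIM('a)) * r ^ Suc n"
        unfolding c_def r_def power_mult_distrib \<delta>_def power_Suc by (simp only: mult_ac)
    qed
    moreover have "summable (\<lambda>n. r ^ Suc n)"
      unfolding summable_Suc_iff using r by (intro summable_geometric) simp
    ultimately show ?thesis by (simp only: summable_mult)
  qed

  have "\<exists>N. \<forall>i j. N \<le> i \<longrightarrow> N \<le> j \<longrightarrow> d_transport \<alpha> (a i) (a j) < \<epsilon>" if \<epsilon>: "0 < \<epsilon>" for \<epsilon>
  proof -
    obtain N where N: "\<And>m n. N \<le> m \<Longrightarrow> norm (sum c {m..<n}) < \<epsilon>"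
      using \<open>summable c\<close> \<epsilon> unfolding summable_Cauchy by blast
    \<comment> \<open>The bound is uniform in \<open>k\<close>, so only the smaller of the two
      indices has to exceed \<open>N\<close>.\<close>
    have tail: "(\<Sum>l<k. c (i + l)) < \<epsilon>" if "N \<le> i" for i k
    proof -
      have "(\<Sum>l<k. c (i + l)) = sum c {i..<i + k}"
        by (simp add: sum.atLeastLessThan_shift_0[of c i] lessThan_atLeast0)
      then show ?thesis using N[OF that, of "i + k"] by simp
    qed
    have "d_transport \<alpha> (a i) (a j) < \<epsilon>" if "N \<le> i" "N \<le> j" for i j
    proof (cases "i \<le> j")
      case True
      then show ?thesis using up[of i "j - i"] tail[OF that(1), of "j - i"] by simp
    next
      case False
      then show ?thesis using down[of j "i - j"] tail[OF that(2), of "i - j"] by simp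
    qed
    then show ?thesis by blast
  qed
  moreover have "range a \<subseteq> atomic_prob_measures"
    using finite_atomic_measure_distr[OF f_simple] prob_space_distr[OF f_meas\<mu>]
    by (auto simp: atomic_prob_measures_def a_def)
  moreover have "converges_weakly a \<mu>"
    unfolding converges_weakly_def
  proof (intro allI impI)
    fix g :: "'a \<Rightarrow> real" assume g: "continuous_on UNIV g" "bounded (range g)"
    have g_meas[measurable]: "g \<in> borel_measurable borel"
      using g(1) by (rule borel_measurable_continuous_onI)
    obtain B where B: "\<And>x. norm (g x) \<le> B" using g(2) by (auto simp: bounded_iff)
    have "(\<lambda>n. real DIM('a) * \<delta> n) \<longlonglongrightarrow> real DIM('a) * 0"
      unfolding \<delta>_def by (intro tendsto_intros LIMSEQ_Suc LIMSEQ_power_zero) simp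
    then have \<delta>_lim: "(\<lambda>n. real DIM('a) * \<delta> n) \<longlonglongrightarrow> 0" by simp
    have f_lim: "(\<lambda>n. f n x) \<longlonglongrightarrow> x" if "x \<in> A" for x
    proof -
      have "(\<lambda>n. dist (f n x) (h x)) \<longlonglongrightarrow> 0"
        by (rule tendsto_sandwich[OF _ _ tendsto_const \<delta>_lim]) (auto simp: f_dist)
      then have "(\<lambda>n. f n x) \<longlonglongrightarrow> h x" by (rule tendsto_dist_iff[THEN iffD2])
      then show ?thesis using that by (simp add: h_def)
    qed
    \<comment> \<open>Pulled back to \<mu>, weak convergence is dominated convergence:
      \<open>f n x\<close> tends to \<open>x\<close> on \<open>A\<close>, hence almost everywhere,
      and the bound \<open>B\<close> of \<open>g\<close> is integrable on a probability
      space.\<close>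
    have "(\<lambda>n. \<integral>x. g (f n x) \<partial>\<mu>) \<longlonglongrightarrow> (\<integral>x. g x \<partial>\<mu>)"
    proof (rule integral_dominated_convergence[where w = "\<lambda>_. B"])
      show "AE x in \<mu>. (\<lambda>n. g (f n x)) \<longlonglongrightarrow> g x"
        using AE_A
      proof eventually_elim
        case (elim x)
        then show ?case
          using f_lim by (intro continuous_on_tendsto_compose[OF g(1)]) auto
      qed
    qed (use B in auto)
    then show "(\<lambda>n. \<integral>x. g x \<partial>a n) \<longlonglongrightarrow> (\<integral>x. g x \<partial>\<mu>)"
      unfolding a_def by (simp add: integral_distr[OF f_meas\<mu> g_meas])
  qed
  ultimately show ?thesis
    using prob by (auto simp: P_transport_def intro!: exI[of _ a])
qed

theorem theorem2p3p7:
  fixes \<alpha> :: real and \<mu> :: "(real ^ 'm) measure" and A :: "(real ^ 'm) set"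
  assumes "0 \<le> \<alpha>" and "\<alpha> < 1"
    and "prob_space \<mu>" and "sets \<mu> = sets borel"
    and "concentrated_on \<mu> A"
    and "box_dim A < ereal (1 / (1 - \<alpha>))"
  shows "\<mu> \<in> P_transport \<alpha>"
  using assms(1,2,3,5,6) by (rule P_transport_if_box_dim_less)

end
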